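(* Let $G=(V,E)$ be a finite simple graph and let $g:V\to\mathbb{R}$ be locally injective, i.e. $g(x)\neq g(y)$ whenever $(x,y)\in E$. For $x\in V$ let $S_g(x)$ be the subgraph of $G$ induced by $\{y\in S(x): g(y)<g(x)\}$, where $S(x)$ is the unit sphere of $x$. Then $$ f_G(t) = 1 + t\sum_{x\in V} f_{S_g(x)}(t). $$
   Context: For a finite simple graph $H$, a $k$-dimensional clique is a complete subgraph with $k+1$ vertices, and $f_k(H)$ denotes the number of $k$-dimensional cliques in $H$. The $f$-function of $H$ is the polynomial $f_H(t)=1+f_0(H)\,t+f_1(H)\,t^2+\cdots+f_d(H)\,t^{d+1}$, where $d$ is the maximal dimension of a clique in $H$; for the empty graph $f_H(t)=1$. The unit sphere $S(x)$ of a vertex $x$ is the subgraph of $G$ induced by the set of neighbors of $x$. *)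

theory Defs
  imports
    "Graph_Theory.Graph_Theory"
    "HOL-Computational_Algebra.Polynomial"
    Complex_Main
begin

text \<open>
  A finite simple graph is a graph in the sense of \<^locale>\<open>graph\<close>: a finite, loop-free, symmetric
  digraph without parallel arcs, so that an undirected edge is a pair of opposite arcs.  The null
  graph is allowed.
\<close>

definition cliques :: "nat \<Rightarrow> ('a, 'b) pre_digraph \<Rightarrow> ('a, 'b) pre_digraph set" where
  "cliques k H = {C. subgraph C H \<and> complete_digraph (k + 1) C}"

definition f_number :: "nat \<Rightarrow> ('a, 'b) pre_digraph \<Rightarrow> nat" where
  "f_number k H = card (cliques k H)"

text \<open>The value on the null graph, where the set of dimensions is empty, is unspecified.\<close>

definition max_clique_dim :: "('a, 'b) pre_digraph \<Rightarrow> nat" where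
  "max_clique_dim H = Max {k. cliques k H \<noteq> {}}"

definition f_function :: "('a, 'b) pre_digraph \<Rightarrow> int poly" where
  "f_function H =
     (if verts H = {} then 1
      else 1 + (\<Sum>k = 0..max_clique_dim H. monom (int (f_number k H)) (k + 1)))"

definition unit_sphere :: "('a, 'b) pre_digraph \<Rightarrow> 'a \<Rightarrow> ('a, 'b) pre_digraph" where
  "unit_sphere G x = G \<restriction> {y. x \<rightarrow>\<^bsub>G\<^esub> y}"

definition sub_sphere ::
    "('a, 'b) pre_digraph \<Rightarrow> ('a \<Rightarrow> real) \<Rightarrow> 'a \<Rightarrow> ('a, 'b) pre_digraph" where
  "sub_sphere G g x = G \<restriction> {y \<in> verts (unit_sphere G x). g y < g x}"

definition locally_injective :: "('a, 'b) pre_digraph \<Rightarrow> ('a \<Rightarrow> real) \<Rightarrow> bool" where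
  "locally_injective G g \<longleftrightarrow> (\<forall>x y. x \<rightarrow>\<^bsub>G\<^esub> y \<longrightarrow> g x \<noteq> g y)"

end

theory Submission
  imports Defs
begin

text \<open>
  A clique of a finite simple graph is determined by its vertex set, so the f-function is the sum
  of \<open>t ^ card S\<close> over all sets \<open>S\<close> of pairwise adjacent vertices, including the empty set.
  Since \<open>g\<close> is injective on such sets, every nonempty one has a unique vertex \<open>x\<close> maximizing
  \<open>g\<close>; removing it leaves a set of pairwise adjacent vertices of \<open>S\<^sub>g(x)\<close>, and every such set
  arises in this way.
\<close>

definition clique_sets :: "('a, 'b) pre_digraph \<Rightarrow> 'a set set" where
  "clique_sets H = {S. S \<subseteq> verts H \<and> (\<forall>u \<in> S. \<forall>v \<in> S. u \<noteq> v \<longrightarrow> u \<rightarrow>\<^bsub>H\<^esub> v)}"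

lemma empty_in_clique_sets [simp]: "{} \<in> clique_sets H"
  by (simp add: clique_sets_def)

lemma (in fin_digraph) finite_clique_sets: "finite (clique_sets G)"
  by (rule finite_subset [of _ "Pow (verts G)"]) (auto simp: clique_sets_def)

lemma (in fin_digraph) finite_clique_set: "S \<in> clique_sets G \<Longrightarrow> finite S"
  using finite_verts by (auto simp: clique_sets_def intro: finite_subset)

lemma dominates_induce_subgraph_iff:
  "u \<rightarrow>\<^bsub>G \<restriction> S\<^esub> v \<longleftrightarrow> u \<in> S \<and> v \<in> S \<and> u \<rightarrow>\<^bsub>G\<^esub> v"
  by (auto simp: arcs_ends_conv)

text \<open>Needed twice: to see that a set of pairwise adjacent vertices spans a clique, and to
  apply results about graphs to the sub-spheres.\<close>

lemma (in graph) graph_induce_subgraph: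
  assumes "S \<subseteq> verts G"
  shows "graph (G \<restriction> S)"
proof -
  have "digraph (G \<restriction> S)"
    using assms by (intro digraph_subgraph induced_imp_subgraph induced_induce)
  moreover have "symmetric (G \<restriction> S)"
    using sym_arcs by (auto simp: symmetric_def sym_def dominates_induce_subgraph_iff)
  ultimately show ?thesis
    by (rule digraph.graphI)
qed

text \<open>An arc of \<open>G\<close> between two vertices of \<open>C\<close> is not a loop, so
  completeness of \<open>C\<close> provides an arc with the same ends; as \<open>G\<close> has no
  parallel arcs, the two coincide. Hence counting cliques as subgraphs amounts to counting their
  vertex sets.\<close>

lemma (in digraph) clique_eq_induce_subgraph:
  assumes "C \<in> cliques k G"
  shows "C = G \<restriction> verts C"
proof (rule pre_digraph.equality)
  have sub: "subgraph C G" and complete: "complete_digraph (k + 1) C"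
    using assms by (auto simp: cliques_def)
  have ends: "tail C = tail G" "head C = head G"
    using sub by (auto simp: subgraph_def compatible_def)
  show "arcs C = arcs (G \<restriction> verts C)"
  proof
    show "arcs C \<subseteq> arcs (G \<restriction> verts C)"
      using sub ends by (auto simp: subgraph_def dest: wf_digraph.wellformed)
    show "arcs (G \<restriction> verts C) \<subseteq> arcs C"
    proof
      fix e
      assume "e \<in> arcs (G \<restriction> verts C)"
      then have e: "e \<in> arcs G" "tail G e \<in> verts C" "head G e \<in> verts C"
        by auto
      then have "tail G e \<rightarrow>\<^bsub>C\<^esub> head G e"
        using complete no_loops by (auto simp: complete_digraph_def)
      then obtain e' where e': "e' \<in> arcs C" "tail C e' = tail G e" "head C e' = head G e"
        by (rule reachableE)
      then have "e' = e"
        using e sub ends by (intro no_multi_arcs) (auto simp: arc_to_ends_def)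
      with e' show "e \<in> arcs C"
        by simp
    qed
  qed
qed (use assms in \<open>auto simp: cliques_def subgraph_def compatible_def\<close>)

text \<open>The inverse map takes a set of vertices to the subgraph it induces.\<close>

lemma (in graph) bij_betw_verts_cliques:
  "bij_betw verts (cliques k G) {S \<in> clique_sets G. card S = k + 1}"
  unfolding bij_betw_def
proof
  show "inj_on verts (cliques k G)"
    by (rule inj_onI) (metis clique_eq_induce_subgraph)
  show "verts ` cliques k G = {S \<in> clique_sets G. card S = k + 1}" (is "_ = ?R")
  proof
    show "verts ` cliques k G \<subseteq> ?R"
    proof clarify
      fix C
      assume "C \<in> cliques k G"
      then have "subgraph C G" "complete_digraph (k + 1) C"
        by (simp_all add: cliques_def)
      then show "verts C \<in> clique_sets G \<and> card (verts C) = k + 1"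
        using subgraph_imp_subverts [of C G] arcs_ends_mono [of C G]
        by (auto simp: clique_sets_def complete_digraph_def)
    qed
    show "?R \<subseteq> verts ` cliques k G"
    proof
      fix S
      assume S: "S \<in> ?R"
      then have "S \<subseteq> verts G"
        by (auto simp: clique_sets_def)
      then have "graph (G \<restriction> S)" "subgraph (G \<restriction> S) G"
        by (auto intro: graph_induce_subgraph induced_imp_subgraph induced_induce)
      moreover have "arcs_ends (G \<restriction> S) = {(u, v). (u, v) \<in> S \<times> S \<and> u \<noteq> v}"
        using S adj_not_same by (auto simp: dominates_induce_subgraph_iff clique_sets_def)
      ultimately have "G \<restriction> S \<in> cliques k G"
        using S by (simp add: cliques_def complete_digraph_def)
      then show "S \<in> verts ` cliques k G"
        by (metis imageI induce_subgraph_verts)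
    qed
  qed
qed

lemma (in graph) f_number_eq: "f_number k G = card {S \<in> clique_sets G. card S = k + 1}"
  unfolding f_number_def by (rule bij_betw_same_card [OF bij_betw_verts_cliques])

text \<open>Ensures that cutting the sum in \<open>f_function\<close> at
  \<open>max_clique_dim\<close> loses no clique. Since that bound is a \<open>Max\<close>, the set
  of dimensions has to be shown finite, which holds because dimensions stay below the number of
  vertices.\<close>

lemma (in graph) card_clique_set_le_max_clique_dim:
  assumes "S \<in> clique_sets G" "S \<noteq> {}"
  shows "card S - 1 \<le> max_clique_dim G"
  unfolding max_clique_dim_def
proof (rule Max_ge)
  have "k < card (verts G)" if "cliques k G \<noteq> {}" for k
  proof -
    from that have "{S \<in> clique_sets G. card S = k + 1} \<noteq> {}"
      using bij_betw_verts_cliques [of k] by (auto simp: bij_betw_def simp del: Collect_empty_eq)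
    then obtain S where "S \<subseteq> verts G" "card S = k + 1"
      by (auto simp: clique_sets_def)
    then show ?thesis
      using card_mono [OF finite_verts, of S] by simp
  qed
  then show "finite {k. cliques k G \<noteq> {}}"
    by (intro finite_subset [OF _ finite_lessThan [of "card (verts G)"]]) auto
  have "card S = (card S - 1) + 1"
    using assms finite_clique_set [of S] by (simp add: card_gt_0_iff)
  then have "S \<in> verts ` cliques (card S - 1) G"
    using assms bij_betw_verts_cliques [of "card S - 1"] unfolding bij_betw_def by blast
  then show "card S - 1 \<in> {k. cliques k G \<noteq> {}}"
    by blast
qed

lemma (in graph) f_function_eq_sum_clique_sets:
  "f_function G = (\<Sum>S \<in> clique_sets G. monom 1 (card S))"
proof (cases "verts G = {}")
  case True
  then have "clique_sets G = {{}}"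
    by (auto simp: clique_sets_def)
  with True show ?thesis
    by (simp add: f_function_def)
next
  case False
  let ?D = "max_clique_dim G"
  let ?N = "clique_sets G - {{}}"
  \<comment> \<open>Subtraction on naturals gives \<open>card {} - 1 = 0\<close>, so the empty set
    would be counted among the single vertices; this is why \<open>?N\<close> leaves it out.\<close>
  have level: "{S \<in> ?N. card S - 1 = k} = {S \<in> clique_sets G. card S = k + 1}" for k
  proof -
    have "card S = Suc (card S - 1)" if "S \<in> ?N" for S
      using that finite_clique_set by (auto simp: card_gt_0_iff)
    then show ?thesis
      by fastforce
  qed
  have "monom (int (f_number k G)) (k + 1) = (\<Sum>S | S \<in> ?N \<and> card S - 1 = k. monom 1 (card S))"
    for k
  proof -
    have "(\<Sum>S | S \<in> ?N \<and> card S - 1 = k. monom (1 :: int) (card S))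
        = (\<Sum>S | S \<in> ?N \<and> card S - 1 = k. monom 1 (k + 1))"
      using level by (intro sum.cong refl) auto
    then show ?thesis
      unfolding level f_number_eq by (simp add: of_nat_poly smult_monom)
  qed
  then have "(\<Sum>k = 0..?D. monom (int (f_number k G)) (k + 1))
      = (\<Sum>k = 0..?D. \<Sum>S | S \<in> ?N \<and> card S - 1 = k. monom 1 (card S))"
    by simp
  also have "\<dots> = (\<Sum>S \<in> ?N. monom 1 (card S))"
    using finite_clique_sets card_clique_set_le_max_clique_dim
    by (intro sum.group image_subsetI) simp_all
  finally show ?thesis
    using False finite_clique_sets
    by (simp add: f_function_def sum.remove [of "clique_sets G" "{}"])
qed

lemma sub_sphere_eq: "sub_sphere G g x = G \<restriction> {y. x \<rightarrow>\<^bsub>G\<^esub> y \<and> g y < g x}"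
  by (simp add: sub_sphere_def unit_sphere_def)

lemma (in graph) graph_sub_sphere: "graph (sub_sphere G g x)"
  unfolding sub_sphere_eq by (rule graph_induce_subgraph) (auto dest: adj_in_verts)

text \<open>An induced subgraph inherits its adjacency from \<open>G\<close>, so cliques of every
  sub-sphere can be handled inside \<open>G\<close> itself.\<close>

lemma (in wf_digraph) clique_sets_sub_sphere:
  "clique_sets (sub_sphere G g x) = {S \<in> clique_sets G. \<forall>y \<in> S. x \<rightarrow>\<^bsub>G\<^esub> y \<and> g y < g x}"
  unfolding sub_sphere_eq clique_sets_def
  by (auto simp: dominates_induce_subgraph_iff dest: adj_in_verts)

text \<open>Membership in the sub-sphere yields the arcs leaving \<open>x\<close>; symmetry of
  \<open>G\<close> supplies those back to \<open>x\<close>.\<close>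

lemma (in graph) insert_in_clique_sets:
  assumes "x \<in> verts G" "S \<in> clique_sets (sub_sphere G g x)"
  shows "insert x S \<in> clique_sets G"
  using assms graph_symmetric unfolding clique_sets_sub_sphere by (auto simp: clique_sets_def)

lemma (in graph) bij_betw_insert_clique_sets:
  assumes "locally_injective G g"
  shows "bij_betw (\<lambda>(x, S). insert x S)
    (SIGMA x : verts G. clique_sets (sub_sphere G g x)) (clique_sets G - {{}})"
  unfolding bij_betw_def
proof
  let ?P = "SIGMA x : verts G. clique_sets (sub_sphere G g x)"
  have lower: "g y < g x" if "S \<in> clique_sets (sub_sphere G g x)" "y \<in> S" for x y S
    using that by (auto simp: clique_sets_sub_sphere)
  show "inj_on (\<lambda>(x, S). insert x S) ?P"
  proof (rule inj_onI, clarify)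
    fix x S y T
    assume *: "S \<in> clique_sets (sub_sphere G g x)" "T \<in> clique_sets (sub_sphere G g y)"
      "insert x S = insert y T"
    \<comment> \<open>Otherwise \<open>x\<close> lies in \<open>T\<close> and \<open>y\<close> in
      \<open>S\<close>, which gives both \<open>g x < g y\<close> and
      \<open>g y < g x\<close>.\<close>
    then have "x = y"
      by (metis insert_iff lower order_less_asym)
    moreover have "x \<notin> S" "y \<notin> T"
      using * lower by blast+
    ultimately show "x = y \<and> S = T"
      using * by (metis insert_ident)
  qed
  show "(\<lambda>(x, S). insert x S) ` ?P = clique_sets G - {{}}"
  proof
    show "(\<lambda>(x, S). insert x S) ` ?P \<subseteq> clique_sets G - {{}}"
      using insert_in_clique_sets by auto
    show "clique_sets G - {{}} \<subseteq> (\<lambda>(x, S). insert x S) ` ?P"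
    proof
      fix S
      assume S: "S \<in> clique_sets G - {{}}"
      then have "finite S" "S \<noteq> {}"
        using finite_clique_set by auto
      then have "Max (g ` S) \<in> g ` S"
        by simp
      then obtain x where x: "x \<in> S" "g x = Max (g ` S)"
        by auto
      then have max: "g y \<le> g x" if "y \<in> S" for y
        using that \<open>finite S\<close> by simp
      \<comment> \<open>Maximality alone gives a weak inequality; it is strict because
        \<open>x\<close> and \<open>y\<close> are adjacent and \<open>g\<close> separates adjacent
        vertices.\<close>
      have "x \<rightarrow>\<^bsub>G\<^esub> y \<and> g y < g x" if "y \<in> S - {x}" for y
      proof
        show "x \<rightarrow>\<^bsub>G\<^esub> y"
          using that S x(1) by (auto simp: clique_sets_def)
        then have "g x \<noteq> g y"
          using assms by (simp add: locally_injective_def)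
        with max [of y] that show "g y < g x"
          by simp
      qed
      moreover have "S - {x} \<in> clique_sets G"
        using S by (auto simp: clique_sets_def)
      ultimately have "S - {x} \<in> clique_sets (sub_sphere G g x)"
        by (simp add: clique_sets_sub_sphere)
      then have "(x, S - {x}) \<in> ?P"
        using S x(1) by (auto simp: clique_sets_def)
      then show "S \<in> (\<lambda>(x, S). insert x S) ` ?P"
        using x(1) by (intro image_eqI [where x = "(x, S - {x})"]) auto
    qed
  qed
qed

theorem theorem1:
  fixes G :: "('a, 'b) pre_digraph" and g :: "'a \<Rightarrow> real"
  assumes "graph G"
    and "locally_injective G g"
  shows "f_function G = 1 + [:0, 1:] * (\<Sum>x \<in> verts G. f_function (sub_sphere G g x))"
proof -
  interpret graph G by fact
  let ?c = "\<lambda>x. clique_sets (sub_sphere G g x)"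
  have card_insert: "card (insert x S) = Suc (card S)" if "S \<in> ?c x" for x S
  proof -
    have "finite S" "x \<notin> S"
      using that finite_clique_set by (auto simp: clique_sets_sub_sphere)
    then show ?thesis
      by simp
  qed
  have fin: "finite (?c x)" for x
    using finite_clique_sets by (simp add: clique_sets_sub_sphere)
  have "(\<Sum>S \<in> clique_sets G - {{}}. monom (1 :: int) (card S))
      = (\<Sum>(x, S) \<in> Sigma (verts G) ?c. monom 1 (card (insert x S)))"
    using sum.reindex_bij_betw [OF bij_betw_insert_clique_sets [OF assms(2)],
        of "\<lambda>S. monom 1 (card S)", symmetric]
    by (simp only: case_prod_beta')
  also have "\<dots> = (\<Sum>x \<in> verts G. \<Sum>S \<in> ?c x. monom 1 (card (insert x S)))"
    using fin by (simp add: sum.Sigma)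
  \<comment> \<open>The top vertex \<open>x\<close> is not in \<open>S\<close>, so it raises the
    degree by exactly one: this is the factor \<open>t\<close>.\<close>
  also have "\<dots> = (\<Sum>x \<in> verts G. \<Sum>S \<in> ?c x. [:0, 1:] * monom 1 (card S))"
    using card_insert by (intro sum.cong refl) (simp add: monom_Suc)
  also have "\<dots> = [:0, 1:] * (\<Sum>x \<in> verts G. f_function (sub_sphere G g x))"
    by (simp add: graph.f_function_eq_sum_clique_sets [OF graph_sub_sphere] sum_distrib_left)
  finally show ?thesis
    using finite_clique_sets
    by (simp add: f_function_eq_sum_clique_sets sum.remove [of "clique_sets G" "{}"])
qed

end
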